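(* Let $M\ge1$. There is an element-based generator $\mathds{G}$ (which may use $M$) such that, for any countable collection $\mathcal{L}$, target language $K\in\mathcal{L}$, and error parameter $\varepsilon\in(0,1)$ given to it, on any enumeration $x_{1:\infty}$ of $K$ with $o(1)$-noise rate and arbitrary omissions that is an $M$-bounded displacement enumeration with respect to $K$, the output $w_{1:\infty}$ of $\mathds{G}$ satisfies $\mu_{\rm low}(\{w_1,w_2,\dots\},K)\ge\frac{1-\varepsilon}{2M}$.
   Context: The universe is $U=\mathbb{N}$ with its natural order; a language is an infinite subset of $U$ with canonical enumeration $\ell_1<\ell_2<\cdots$; a collection is a countable family of languages. For $A,B\subseteq\mathbb{N}$ with $B=\{b_1<b_2<\cdots\}$, $\mu_{\rm low}(A,B)=\liminf_n\frac1n|A\cap\{b_1,\dots,b_n\}|$. For $x\in U$, $\sigma(x,L)=j$ if $x=\ell_j$ and $0$ if $x\notin L$; $x_{1:\infty}$ is an $M$-bounded displacement enumeration with respect to $L$ if there is $n^\star$ with $\sigma(x_n,L)\le Mn$ for all $n\ge n^\star$. An enumeration of $K$ with $o(1)$-noise and arbitrary omissions is a sequence of distinct elements listing each element of some infinite $\hat K\subseteq K$ exactly once, with $\frac1n|\{t\le n:x_t\notin\hat K\}|\to0$. An element-based generator outputs, from $x_1,\dots,x_n$ and knowledge of $\mathcal{L}$ (not $K$), an element $w_n\notin\{x_1,\dots,x_n,w_1,\dots,w_{n-1}\}$. *)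

theory Defs
  imports "HOL-Analysis.Analysis" "HOL-Library.Infinite_Set"
begin

text \<open>Sequences are 0-indexed: x 0 is x_1 of the paper, x t is x_(t+1).\<close>

definition sigma :: "nat \<Rightarrow> nat set \<Rightarrow> nat" where
  "sigma x L = (if x \<in> L then card {y \<in> L. y < x} + 1 else 0)"

definition mu_low :: "nat set \<Rightarrow> nat set \<Rightarrow> ereal" where
  "mu_low A B = liminf (\<lambda>n. ereal (real (card (A \<inter> {enumerate B i | i. i < n})) / real n))"

text \<open>M-bounded displacement enumeration w.r.t. L (1-based index n = t+1).\<close>
definition bounded_displacement :: "real \<Rightarrow> (nat \<Rightarrow> nat) \<Rightarrow> nat set \<Rightarrow> bool" where
  "bounded_displacement M x L \<longleftrightarrow>
     (\<exists>n0. \<forall>t\<ge>n0. real (sigma (x t) L) \<le> M * real (t + 1))"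

definition noisy_enum :: "(nat \<Rightarrow> nat) \<Rightarrow> nat set \<Rightarrow> bool" where
  "noisy_enum x K \<longleftrightarrow> inj x \<and>
     (\<exists>Kh. Kh \<subseteq> K \<and> infinite Kh \<and> Kh \<subseteq> range x \<and>
        (\<lambda>n. real (card {t. t < n \<and> x t \<notin> Kh}) / real n) \<longlonglongrightarrow> 0)"

text \<open>Output of a generator G (given the collection as an enumeration Ls of
  its languages and the error parameter eps) on input x: the n-th output
  (0-based) is computed from the prefix x_1..x_(n+1).\<close>
definition gen_out ::
  "((nat \<Rightarrow> nat set) \<Rightarrow> real \<Rightarrow> nat list \<Rightarrow> nat) \<Rightarrow> (nat \<Rightarrow> nat set) \<Rightarrow> real \<Rightarrow> (nat \<Rightarrow> nat) \<Rightarrow> nat \<Rightarrow> nat" where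
  "gen_out G Ls eps x n = G Ls eps (map x [0..<Suc n])"

definition element_based ::
  "((nat \<Rightarrow> nat set) \<Rightarrow> real \<Rightarrow> nat list \<Rightarrow> nat) \<Rightarrow> bool" where
  "element_based G \<longleftrightarrow> (\<forall>Ls eps x n.
     gen_out G Ls eps x n \<notin> x ` {..n} \<union> gen_out G Ls eps x ` {..<n})"

end

theory Submission
  imports Defs
begin

text \<open>
  Call an index \<open>t\<close> a miss of a language \<open>L\<close> if \<open>x t\<close> is outside \<open>L\<close> or violates the displacement
  bound. The target \<open>K\<close> has \<open>o(n)\<close> misses. At level \<open>k\<close>, a language \<open>L\<^sub>i\<close> with \<open>i < k\<close> is plausible
  while its misses stay below \<open>\<epsilon> m / 2^(i+1)\<close> at all times \<open>m \<ge> k\<close>. This can only be lost, so for a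
  fixed level the plausible set stabilises, and at a suitable level it contains \<open>K\<close> forever. The
  generator takes the highest level at which some unseen element has rank at most
  \<open>2 M n / (1 - \<epsilon>)\<close> in every plausible language. A stabilised level always qualifies: among the
  first \<open>m = \<lfloor>2 n / (1 - \<epsilon>)\<rfloor>\<close> inputs, including those not seen yet, at least \<open>(1 - \<epsilon>) m > 2 n - 1\<close> are
  misses of no plausible language, while at most \<open>2 n - 1\<close> elements have been used. So eventually
  the \<open>n\<close>-th output has rank at most \<open>2 M n / (1 - \<epsilon>)\<close> in \<open>K\<close>, which gives the density.
\<close>

definition near :: "real \<Rightarrow> nat set \<Rightarrow> nat \<Rightarrow> bool" where
  "near c L y \<longleftrightarrow> y \<in> L \<and> real (sigma y L) \<le> c"

definition misses :: "real \<Rightarrow> nat set \<Rightarrow> (nat \<Rightarrow> nat) \<Rightarrow> nat \<Rightarrow> nat set" where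
  "misses M L x m = {t. t < m \<and> \<not> near (M * real (t + 1)) L (x t)}"

text \<open>The budgets \<open>eps / 2 ^ (i + 1)\<close> sum to at most \<open>eps\<close>, so all
  plausible languages together have at most \<open>eps * m\<close> misses. Times before
  \<open>k\<close> are forgiven, hence a higher level can only admit more languages.\<close>

definition plausible ::
  "real \<Rightarrow> (nat \<Rightarrow> nat set) \<Rightarrow> real \<Rightarrow> (nat \<Rightarrow> nat) \<Rightarrow> nat \<Rightarrow> nat \<Rightarrow> nat set" where
  "plausible M Ls eps x n k =
     {i. i < k \<and> (\<forall>m\<in>{k..n}. real (card (misses M (Ls i) x m)) \<le> eps / 2 ^ (i + 1) * real m)}"

definition candidate ::
  "real \<Rightarrow> (nat \<Rightarrow> nat set) \<Rightarrow> real \<Rightarrow> (nat \<Rightarrow> nat) \<Rightarrow> nat \<Rightarrow> nat set \<Rightarrow> nat \<Rightarrow> nat \<Rightarrow> bool" where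
  "candidate M Ls eps x n S k w \<longleftrightarrow>
     w \<notin> S \<and> (\<forall>i\<in>plausible M Ls eps x n k. near (2 * M / (1 - eps) * real n) (Ls i) w)"

text \<open>The cap \<open>k \<le> n\<close> guarantees a greatest level, since candidates may exist
  at every level.\<close>

definition best_level ::
  "real \<Rightarrow> (nat \<Rightarrow> nat set) \<Rightarrow> real \<Rightarrow> (nat \<Rightarrow> nat) \<Rightarrow> nat \<Rightarrow> nat set \<Rightarrow> nat" where
  "best_level M Ls eps x n S = (GREATEST k. k \<le> n \<and> (\<exists>w. candidate M Ls eps x n S k w))"

definition pick ::
  "real \<Rightarrow> (nat \<Rightarrow> nat set) \<Rightarrow> real \<Rightarrow> (nat \<Rightarrow> nat) \<Rightarrow> nat \<Rightarrow> nat set \<Rightarrow> nat" where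
  "pick M Ls eps x n S = (SOME w. candidate M Ls eps x n S (best_level M Ls eps x n S) w)"

text \<open>The input list is in reverse order here, and so is the resulting list of outputs.\<close>

primrec outputs :: "real \<Rightarrow> (nat \<Rightarrow> nat set) \<Rightarrow> real \<Rightarrow> nat list \<Rightarrow> nat list" where
  "outputs M Ls eps [] = []"
| "outputs M Ls eps (y # ys) =
     pick M Ls eps (nth (rev (y # ys))) (length (y # ys)) (set (y # ys) \<union> set (outputs M Ls eps ys))
       # outputs M Ls eps ys"

definition generator :: "real \<Rightarrow> (nat \<Rightarrow> nat set) \<Rightarrow> real \<Rightarrow> nat list \<Rightarrow> nat" where
  "generator M Ls eps xs = hd (outputs M Ls eps (rev xs))"

section \<open>The generator as a recurrence on its outputs\<close>

lemma plausible_mono: "k \<le> l \<Longrightarrow> plausible M Ls eps x n k \<subseteq> plausible M Ls eps x n l"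
  by (auto simp: plausible_def)

lemma plausible_cong:
  assumes "\<And>t. t < n \<Longrightarrow> x t = y t"
  shows "plausible M Ls eps x n k = plausible M Ls eps y n k"
proof -
  have "misses M L x m = misses M L y m" if "m \<le> n" for L m
    using assms that by (auto simp: misses_def)
  then show ?thesis by (auto simp: plausible_def)
qed

text \<open>This lets the full sequence stand in for the finite list, whose \<open>nth\<close> is
  unspecified past its end.\<close>

lemma pick_cong:
  assumes "\<And>t. t < n \<Longrightarrow> x t = y t"
  shows "pick M Ls eps x n S = pick M Ls eps y n S"
  using plausible_cong[of n x y, OF assms] by (simp add: pick_def best_level_def candidate_def)

lemma pick_candidate:
  assumes "finite S"
  shows "candidate M Ls eps x n S (best_level M Ls eps x n S) (pick M Ls eps x n S)"
proof -
  obtain w where "w \<notin> S" using assms ex_new_if_finite by blast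
  \<comment> \<open>No language is plausible at level 0, so any fresh element is a candidate there
    and the search never fails.\<close>
  then have "0 \<le> n \<and> (\<exists>w. candidate M Ls eps x n S 0 w)"
    by (auto simp: candidate_def plausible_def)
  then have "\<exists>w. candidate M Ls eps x n S (best_level M Ls eps x n S) w"
    unfolding best_level_def
    by (rule GreatestI_nat[where P = "\<lambda>k. k \<le> n \<and> (\<exists>w. candidate M Ls eps x n S k w)" and b = n,
          THEN conjunct2]) auto
  then show ?thesis unfolding pick_def by (rule someI_ex)
qed

lemma best_level_ge:
  assumes "candidate M Ls eps x n S k w" and "k \<le> n"
  shows "k \<le> best_level M Ls eps x n S"
  unfolding best_level_def by (rule Greatest_le_nat[where b = n]) (use assms in auto)

lemma outputs_gen_out:
  "outputs M Ls eps (rev (map x [0..<n])) = rev (map (gen_out (generator M) Ls eps x) [0..<n])"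
proof (induction n)
  case (Suc n)
  have "gen_out (generator M) Ls eps x n = hd (outputs M Ls eps (rev (map x [0..<Suc n])))"
    by (simp add: gen_out_def generator_def)
  then show ?case using Suc by simp
qed simp

lemma gen_out_eq_pick:
  "gen_out (generator M) Ls eps x n =
     pick M Ls eps x (Suc n) (x ` {..n} \<union> gen_out (generator M) Ls eps x ` {..<n})"
proof -
  have "gen_out (generator M) Ls eps x n = hd (outputs M Ls eps (x n # rev (map x [0..<n])))"
    by (simp add: gen_out_def generator_def)
  also have "\<dots> = pick M Ls eps (nth (map x [0..<Suc n])) (Suc n)
      (x ` {..n} \<union> gen_out (generator M) Ls eps x ` {..<n})"
  proof -
    have "set (x n # rev (map x [0..<n])) = x ` {..n}"
      by (auto simp: less_le)
    then show ?thesis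
      by (simp add: outputs_gen_out atLeast0LessThan del: upt_Suc set_simps) (simp add: rev_map)
  qed
  also have "\<dots> = pick M Ls eps x (Suc n) (x ` {..n} \<union> gen_out (generator M) Ls eps x ` {..<n})"
    by (rule pick_cong) (simp del: upt_Suc)
  finally show ?thesis .
qed

lemma element_based_generator: "element_based (generator M)"
  unfolding element_based_def
proof (intro allI)
  fix Ls eps x n
  let ?S = "x ` {..n} \<union> gen_out (generator M) Ls eps x ` {..<n}"
  have "pick M Ls eps x (Suc n) ?S \<notin> ?S"
    using pick_candidate[of ?S M Ls eps x "Suc n"] by (simp add: candidate_def)
  then show "gen_out (generator M) Ls eps x n \<notin> ?S"
    by (metis gen_out_eq_pick)
qed

lemma inj_gen_out: "inj (gen_out (generator M) Ls eps x)"
proof (rule linorder_injI)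
  fix m n :: nat assume "m < n"
  then show "gen_out (generator M) Ls eps x m \<noteq> gen_out (generator M) Ls eps x n"
    using element_based_generator[of M] unfolding element_based_def by (metis UnI2 imageI lessThan_iff)
qed

section \<open>Miss counts and stable levels\<close>

lemma misses_target_le:
  assumes "noisy_enum x K" and "bounded_displacement M x K" and "0 < d"
  shows "\<exists>N. \<forall>m\<ge>N. real (card (misses M K x m)) \<le> d * real m"
proof -
  obtain Kh where Kh: "Kh \<subseteq> K"
    and lim: "(\<lambda>n. real (card {t. t < n \<and> x t \<notin> Kh}) / real n) \<longlonglongrightarrow> 0"
    using assms(1) by (auto simp: noisy_enum_def)
  obtain n0 where n0: "\<And>t. t \<ge> n0 \<Longrightarrow> real (sigma (x t) K) \<le> M * real (t + 1)"
    using assms(2) by (auto simp: bounded_displacement_def)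
  have "\<forall>\<^sub>F n in sequentially. real (card {t. t < n \<and> x t \<notin> Kh}) / real n < d / 2"
    by (rule order_tendstoD(2)[OF lim]) (use assms(3) in simp)
  then obtain N1 where N1: "\<And>n. n \<ge> N1 \<Longrightarrow> real (card {t. t < n \<and> x t \<notin> Kh}) / real n < d / 2"
    by (auto simp: eventually_sequentially)
  \<comment> \<open>Half of the budget \<open>d\<close> pays for the noise, the other half for the
    first \<open>n0\<close> indices, where the displacement bound may fail.\<close>
  obtain N2 :: nat where N2: "real n0 \<le> d / 2 * real N2"
  proof -
    obtain k :: nat where "real n0 < real k * (d / 2)"
      using reals_Archimedean3[of "d / 2"] assms(3) by auto
    then show ?thesis by (intro that[of k]) (simp add: mult.commute)
  qed
  have "real (card (misses M K x m)) \<le> d * real m" if m: "m \<ge> Suc (max N1 N2)" for m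
  proof -
    have "misses M K x m \<subseteq> {t. t < m \<and> x t \<notin> Kh} \<union> {..<n0}"
    proof
      fix t assume "t \<in> misses M K x m"
      then show "t \<in> {t. t < m \<and> x t \<notin> Kh} \<union> {..<n0}"
        using n0[of t] Kh by (cases "t < n0") (auto simp: misses_def near_def)
    qed
    then have "card (misses M K x m) \<le> card ({t. t < m \<and> x t \<notin> Kh} \<union> {..<n0})"
      by (intro card_mono) auto
    also have "\<dots> \<le> card {t. t < m \<and> x t \<notin> Kh} + n0"
      using card_Un_le[of "{t. t < m \<and> x t \<notin> Kh}" "{..<n0}"] by simp
    finally have "real (card (misses M K x m)) \<le> real (card {t. t < m \<and> x t \<notin> Kh}) + real n0"
      by linarith
    moreover have "real (card {t. t < m \<and> x t \<notin> Kh}) \<le> d / 2 * real m"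
      using N1[of m] m by (simp add: max_def field_simps split: if_splits)
    moreover have "d / 2 * real N2 \<le> d / 2 * real m"
      using m assms(3) by (intro mult_left_mono) auto
    ultimately show ?thesis using N2 by (simp add: field_simps)
  qed
  then show ?thesis by blast
qed

text \<open>Each of the finitely many languages that ever exceeds its budget does so at some
  definite time \<open>b i\<close>; after the last of these times nothing changes.\<close>

lemma plausible_stable:
  "\<exists>N. \<forall>n\<ge>N. plausible M Ls eps x n k =
     {i. i < k \<and> (\<forall>m\<ge>k. real (card (misses M (Ls i) x m)) \<le> eps / 2 ^ (i + 1) * real m)}"
proof -
  let ?Q = "\<lambda>i m. real (card (misses M (Ls i) x m)) \<le> eps / 2 ^ (i + 1) * real m"
  have "\<forall>i. \<exists>b. (\<forall>m\<ge>k. ?Q i m) \<or> (k \<le> b \<and> \<not> ?Q i b)" by blast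
  then obtain b where b: "\<And>i. (\<forall>m\<ge>k. ?Q i m) \<or> (k \<le> b i \<and> \<not> ?Q i (b i))" by metis
  \<comment> \<open>For \<open>k = 0\<close> this \<open>Max\<close> is unspecified, but both sides
    are then false.\<close>
  have "i \<in> plausible M Ls eps x n k \<longleftrightarrow> i < k \<and> (\<forall>m\<ge>k. ?Q i m)"
    if n: "n \<ge> Max (b ` {..<k})" for n i
  proof
    assume i: "i \<in> plausible M Ls eps x n k"
    then have "i < k" and Q: "\<And>m. k \<le> m \<Longrightarrow> m \<le> n \<Longrightarrow> ?Q i m"
      by (auto simp: plausible_def)
    then have "b i \<le> Max (b ` {..<k})" by (intro Max_ge) auto
    with n have "b i \<le> n" by simp
    then have "\<forall>m\<ge>k. ?Q i m" using b[of i] Q[of "b i"] by blast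
    with \<open>i < k\<close> show "i < k \<and> (\<forall>m\<ge>k. ?Q i m)" by blast
  next
    assume "i < k \<and> (\<forall>m\<ge>k. ?Q i m)"
    then show "i \<in> plausible M Ls eps x n k" by (simp add: plausible_def)
  qed
  then show ?thesis by blast
qed

lemma sum_halves_le_1:
  assumes "finite A"
  shows "(\<Sum>i\<in>A. 1 / 2 ^ (i + 1)) \<le> (1 :: real)"
proof -
  have "(\<lambda>i. (1 / 2 :: real) ^ Suc i) sums 1" by (rule power_half_series)
  then have "(\<Sum>i\<in>A. (1 / 2 :: real) ^ Suc i) \<le> 1"
    using assms by (intro sum_le_suminf[THEN order_trans]) (auto simp: sums_iff)
  then show ?thesis by (simp add: power_one_over)
qed

text \<open>A union bound leaves at least \<open>(1 - eps) * m\<close> indices that no language in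
  \<open>A\<close> misses, and by injectivity \<open>S\<close> cannot contain all their inputs. Here
  \<open>m\<close> may exceed the number of inputs read: unread inputs only witness that
  \<open>w\<close> exists.\<close>

lemma ex_unused_common_near:
  assumes "inj x" and "finite S" and "finite A" and "0 \<le> M" and "0 \<le> eps"
    and miss: "\<And>i. i \<in> A \<Longrightarrow> real (card (misses M (Ls i) x m)) \<le> eps / 2 ^ (i + 1) * real m"
    and S: "real (card S) < (1 - eps) * real m"
  shows "\<exists>w. w \<notin> S \<and> (\<forall>i\<in>A. near (M * real m) (Ls i) w)"
proof -
  define B where "B = (\<Union>i\<in>A. misses M (Ls i) x m)"
  have B: "finite B" "B \<subseteq> {..<m}" using assms(3) by (auto simp: B_def misses_def)
  have "real (card B) \<le> (\<Sum>i\<in>A. real (card (misses M (Ls i) x m)))"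
    unfolding B_def of_nat_sum[symmetric] of_nat_le_iff by (rule card_UN_le[OF assms(3)])
  also have "\<dots> \<le> (\<Sum>i\<in>A. eps * real m * (1 / 2 ^ (i + 1)))"
    using miss by (intro sum_mono) (simp add: mult_ac)
  also have "\<dots> = eps * real m * (\<Sum>i\<in>A. 1 / 2 ^ (i + 1))"
    by (simp only: sum_distrib_left)
  also have "\<dots> \<le> eps * real m * 1"
    using assms(5) by (intro mult_left_mono sum_halves_le_1 assms(3)) auto
  finally have "real (card B) \<le> eps * real m" by simp
  moreover have "real (card ({..<m} - B)) = real m - real (card B)"
    using B card_mono[of "{..<m}" B] by (simp add: card_Diff_subset of_nat_diff)
  ultimately have "real (card S) < real (card ({..<m} - B))"
    using S by (simp add: algebra_simps)
  then have "card S < card (x ` ({..<m} - B))"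
    using assms(1) by (simp add: card_image inj_on_subset)
  then have "\<not> x ` ({..<m} - B) \<subseteq> S"
    using card_mono[OF assms(2)] by (metis not_le)
  then obtain t where t: "t < m" "t \<notin> B" "x t \<notin> S" by auto
  have "near (M * real m) (Ls i) (x t)" if "i \<in> A" for i
  proof -
    have "near (M * real (t + 1)) (Ls i) (x t)"
      using t that by (auto simp: B_def misses_def)
    moreover have "M * real (t + 1) \<le> M * real m"
      using t assms(4) by (intro mult_left_mono) auto
    ultimately show ?thesis by (auto simp: near_def)
  qed
  with t show ?thesis by blast
qed

lemma eventually_near_target:
  assumes "M \<ge> 1" and "0 < eps" and "eps < 1" and "K \<in> range Ls"
    and enum: "noisy_enum x K" and disp: "bounded_displacement M x K"
  shows "\<exists>N. \<forall>n\<ge>N. near (2 * M / (1 - eps) * real (Suc n)) K (gen_out (generator M) Ls eps x n)"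
proof -
  obtain z where z: "K = Ls z" using assms(4) by blast
  obtain N0 where N0: "\<And>m. m \<ge> N0 \<Longrightarrow> real (card (misses M K x m)) \<le> eps / 2 ^ (z + 1) * real m"
    using misses_target_le[OF enum disp, of "eps / 2 ^ (z + 1)"] assms(2) by auto
  \<comment> \<open>Large enough both to include the index \<open>z\<close> and to forgive all times
    at which \<open>K\<close> may exceed its budget.\<close>
  define k where "k = Suc (max z N0)"
  define A where
    "A = {i. i < k \<and> (\<forall>m\<ge>k. real (card (misses M (Ls i) x m)) \<le> eps / 2 ^ (i + 1) * real m)}"
  have zA: "z \<in> A" using N0 by (auto simp: A_def k_def z)
  obtain N1 where N1: "\<And>n. n \<ge> N1 \<Longrightarrow> plausible M Ls eps x n k = A"
    using plausible_stable[of M Ls eps x k] unfolding A_def by blast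
  have inj: "inj x" using enum by (simp add: noisy_enum_def)
  have "near (2 * M / (1 - eps) * real (Suc n)) K (gen_out (generator M) Ls eps x n)"
    if n: "n \<ge> max k N1" for n
  proof -
    define S where "S = x ` {..n} \<union> gen_out (generator M) Ls eps x ` {..<n}"
    have fin: "finite S" by (simp add: S_def)
    have "card S \<le> card (x ` {..n}) + card (gen_out (generator M) Ls eps x ` {..<n})"
      unfolding S_def by (rule card_Un_le)
    also have "\<dots> \<le> Suc n + n"
      using card_image_le[of "{..n}" x] card_image_le[of "{..<n}" "gen_out (generator M) Ls eps x"]
      by simp
    finally have cardS: "card S \<le> Suc n + n" .
    \<comment> \<open>The 2 counts the used elements: \<open>n + 1\<close> inputs and
      \<open>n\<close> outputs. Rounding \<open>r\<close> down costs less than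
      \<open>1 - eps\<close>, so \<open>(1 - eps) * m > 2 * n + 1\<close>.\<close>
    define r where "r = 2 * real (Suc n) / (1 - eps)"
    define m where "m = nat \<lfloor>r\<rfloor>"
    have r: "r * (1 - eps) = 2 * real (Suc n)" using assms(3) by (simp add: r_def)
    have "2 * real (Suc n) \<le> r"
      using assms by (simp add: r_def field_simps)
    then have m: "real m \<le> r" "r < real m + 1" by (auto simp: m_def)
    have "real (Suc n) < real m + 1" using \<open>2 * real (Suc n) \<le> r\<close> m by simp
    then have "k \<le> m" using n by simp
    have "r * (1 - eps) < (real m + 1) * (1 - eps)"
      using m assms(3) by (intro mult_strict_right_mono) auto
    then have "real (card S) < (1 - eps) * real m"
      using cardS r assms(2) by (simp add: algebra_simps)
    then obtain w where w: "w \<notin> S" "\<forall>i\<in>A. near (M * real m) (Ls i) w"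
      using ex_unused_common_near[of x S A M eps Ls m] inj fin assms(1,2) \<open>k \<le> m\<close>
      by (auto simp: A_def)
    have "M * real m \<le> M * r" using m assms(1) by (intro mult_left_mono) auto
    then have "M * real m \<le> 2 * M / (1 - eps) * real (Suc n)"
      by (simp add: r_def mult_ac)
    then have "candidate M Ls eps x (Suc n) S k w"
      using w N1[of "Suc n"] n by (force simp: candidate_def near_def)
    then have "k \<le> best_level M Ls eps x (Suc n) S"
      using n by (intro best_level_ge) auto
    \<comment> \<open>The chosen level may lie above \<open>k\<close> and need not be stable;
      monotonicity in the level keeps the target plausible there.\<close>
    then have "z \<in> plausible M Ls eps x (Suc n) (best_level M Ls eps x (Suc n) S)"
      using plausible_mono[of k _ M Ls eps x "Suc n"] N1[of "Suc n"] n zA by fastforce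
    then have "near (2 * M / (1 - eps) * real (Suc n)) K (pick M Ls eps x (Suc n) S)"
      using pick_candidate[OF fin, of M Ls eps x "Suc n"] unfolding candidate_def z by blast
    then show ?thesis by (metis gen_out_eq_pick S_def)
  qed
  then show ?thesis by blast
qed

section \<open>From rank bounds to lower density\<close>

lemma mem_initial_segment:
  assumes "infinite K" and "near (real N) K y"
  shows "y \<in> {enumerate K i | i. i < N}"
proof -
  have "y \<in> K" using assms(2) by (simp add: near_def)
  then obtain j where j: "enumerate K j = y" using enumerate_Ex[OF assms(1)] by blast
  have "enumerate K ` {..<j} \<subseteq> {z \<in> K. z < y}"
    using assms(1) j by (auto simp: enumerate_in_set enumerate_mono)
  then have "card (enumerate K ` {..<j}) \<le> card {z \<in> K. z < y}"
    by (intro card_mono) auto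
  then have "j \<le> card {z \<in> K. z < y}"
    using assms(1) by (simp add: card_image strict_mono_imp_inj_on[OF strict_mono_enumerate])
  \<comment> \<open>\<open>sigma\<close> counts from 1 and \<open>enumerate\<close> from 0, so the
    rank of \<open>y\<close> is at least \<open>j + 1\<close>.\<close>
  then have "j < N" using assms(2) by (simp add: near_def sigma_def split: if_splits)
  with j show ?thesis by blast
qed

lemma mu_low_ge_of_near:
  assumes "infinite K" and "inj w" and "0 < c"
    and near: "\<And>n. n \<ge> N0 \<Longrightarrow> near (c * real (Suc n)) K (w n)"
  shows "mu_low (range w) K \<ge> ereal (1 / c)"
proof -
  let ?f = "\<lambda>n. real (card (range w \<inter> {enumerate K i | i. i < n})) / real n"
  \<comment> \<open>Outputs with index from \<open>N0\<close> up to about \<open>N / c\<close> are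
    distinct and lie among the first \<open>N\<close> elements of \<open>K\<close>. The loss is
    \<open>N0\<close> for early outputs and 1 for rounding.\<close>
  have bound: "1 / c - (1 + real N0) / real N \<le> ?f N" if "N > 0" for N
  proof -
    define T where "T = nat \<lfloor>real N / c\<rfloor>"
    have T: "real T \<le> real N / c" "real N / c < real T + 1"
      using assms(3) by (auto simp: T_def)
    have "w ` {N0..<T} \<subseteq> range w \<inter> {enumerate K i | i. i < N}"
    proof (intro image_subsetI IntI mem_initial_segment assms(1))
      fix n assume n: "n \<in> {N0..<T}"
      then have "c * real (Suc n) \<le> c * real T"
        using assms(3) by (intro mult_left_mono) auto
      also have "\<dots> \<le> real N" using T assms(3) by (simp add: field_simps)
      finally show "near (real N) K (w n)" using near[of n] n by (auto simp: near_def)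
    qed auto
    then have "card (w ` {N0..<T}) \<le> card (range w \<inter> {enumerate K i | i. i < N})"
      by (intro card_mono) auto
    then have "T - N0 \<le> card (range w \<inter> {enumerate K i | i. i < N})"
      using assms(2) by (simp add: card_image inj_on_subset)
    then have "real N / c - (1 + real N0) \<le> real (card (range w \<inter> {enumerate K i | i. i < N}))"
      using T by linarith
    then have "(real N / c - (1 + real N0)) / real N \<le> ?f N"
      by (rule divide_right_mono) simp
    then show ?thesis using that by (simp add: diff_divide_distrib)
  qed
  have "(\<lambda>N. 1 / c - (1 + real N0) / real N) \<longlonglongrightarrow> 1 / c - 0"
    by (intro tendsto_diff tendsto_const lim_const_over_n)
  then have "(\<lambda>N. ereal (1 / c - (1 + real N0) / real N)) \<longlonglongrightarrow> ereal (1 / c)"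
    by simp
  then have "ereal (1 / c) = liminf (\<lambda>N. ereal (1 / c - (1 + real N0) / real N))"
    by (intro lim_imp_Liminf[symmetric]) auto
  also have "\<dots> \<le> liminf (\<lambda>N. ereal (?f N))"
    using bound by (intro Liminf_mono eventually_sequentiallyI[of 1]) auto
  finally show ?thesis by (simp add: mu_low_def)
qed

theorem theorem7p11:
  fixes M :: real
  assumes "M \<ge> 1"
  shows "\<exists>G. element_based G \<and>
    (\<forall>(Ls :: nat \<Rightarrow> nat set) K (eps :: real) (x :: nat \<Rightarrow> nat).
       (\<forall>i. infinite (Ls i)) \<longrightarrow> K \<in> range Ls \<longrightarrow> 0 < eps \<longrightarrow> eps < 1 \<longrightarrow>
       noisy_enum x K \<longrightarrow> bounded_displacement M x K \<longrightarrow>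
       mu_low (range (gen_out G Ls eps x)) K \<ge> ereal ((1 - eps) / (2 * M)))"
proof (intro exI[of _ "generator M"] conjI element_based_generator allI impI)
  fix Ls :: "nat \<Rightarrow> nat set" and K :: "nat set" and eps :: real and x :: "nat \<Rightarrow> nat"
  assume inf: "\<forall>i. infinite (Ls i)" and K: "K \<in> range Ls" and eps: "0 < eps" "eps < 1"
    and x: "noisy_enum x K" "bounded_displacement M x K"
  obtain N where
    "\<And>n. n \<ge> N \<Longrightarrow> near (2 * M / (1 - eps) * real (Suc n)) K (gen_out (generator M) Ls eps x n)"
    using eventually_near_target[OF assms eps K x] by blast
  moreover have "infinite K" using inf K by auto
  moreover have "0 < 2 * M / (1 - eps)" using assms eps by simp
  ultimately have "ereal (1 / (2 * M / (1 - eps))) \<le> mu_low (range (gen_out (generator M) Ls eps x)) K"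
    using inj_gen_out by (intro mu_low_ge_of_near)
  then show "ereal ((1 - eps) / (2 * M)) \<le> mu_low (range (gen_out (generator M) Ls eps x)) K"
    by simp
qed

end
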